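(* Let $n\ge 1$ and let $f_0, f_1, g_0, g_1$ be four Borel functions from $\mathbb{R}^n$ to $\mathbb{R}\cup\{+\infty\}$ such that, for every $x_0, x_1\in\mathbb{R}^n$, \[ g_0\Bigl(\tfrac{2}{3}x_0+\tfrac13 x_1\Bigr)+g_1\Bigl(\tfrac13 x_0+\tfrac23 x_1\Bigr)\le f_0(x_0)+f_1(x_1). \] Then \[ \Bigl(\int_{\mathbb{R}^n}e^{-g_0(x)}\,dx\Bigr)\Bigl(\int_{\mathbb{R}^n}e^{-g_1(x)}\,dx\Bigr)\ \ge\ \Bigl(\int_{\mathbb{R}^n}e^{-f_0(x)}\,dx\Bigr)\Bigl(\int_{\mathbb{R}^n}e^{-f_1(x)}\,dx\Bigr). \]
   Context: Conventions: $e^{-\infty}=0$; integrals are with respect to Lebesgue measure and take values in $[0,+\infty]$; products in $[0,+\infty]$ use $0\cdot(+\infty)=0$. *)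

theory Defs
  imports "HOL-Analysis.Analysis"
begin

text \<open>The exponential extended to the two-point compactification of the real line,
  with the exponential of minus infinity equal to 0.\<close>

definition exp_ereal :: "ereal \<Rightarrow> ennreal" where
  "exp_ereal t =
     (case t of ereal r \<Rightarrow> ennreal (exp r) | PInfty \<Rightarrow> \<infinity> | MInfty \<Rightarrow> 0)"

lemma exp_ereal_simps [simp]:
  "exp_ereal (ereal r) = ennreal (exp r)"
  "exp_ereal \<infinity> = \<infinity>"
  "exp_ereal (- \<infinity>) = 0"
  by (simp_all add: exp_ereal_def)

end

theory Submission
  imports Defs
begin

text \<open>Write \<open>F = exp (- f)\<close> and \<open>G = exp (- g)\<close>, so that the hypothesis reads
  \<open>F0(x) F1(y) \<le> G0((1 - l) x + l y) G1(l x + (1 - l) y)\<close> with \<open>l = 1/3\<close>; every \<open>l\<close> in the unit interval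
  works. This is a relative of the Prekopa-Leindler inequality, and like it, it follows from
  monotone transport on the line and induction on the dimension.

  On the line, let \<open>u\<close> and \<open>v\<close> map the unit interval to the line in such a way that
  \<open>F0(u) u' = I0\<close> and \<open>F1(v) v' = I1\<close> are constant, namely equal to the integrals of \<open>F0\<close> and \<open>F1\<close>.
  The integral of \<open>G0\<close> is at least that of \<open>G0(w0) w0'\<close> with \<open>w0 = (1 - l) u + l v\<close>, and the integral of
  \<open>G1\<close> at least that of \<open>G1(w1) w1'\<close> with \<open>w1 = l u + (1 - l) v\<close>. By Cauchy-Schwarz the product of the
  integrals is at least the square of the integral of \<open>sqrt (G0(w0) G1(w1) w0' w1')\<close>. By the hypothesis
  and the elementary inequality \<open>w0' w1' \<ge> u' v'\<close> (\<open>mult_le_convex_combinations_mult\<close>), the integrand is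
  at least \<open>sqrt (F0(u) F1(v) u' v') = sqrt (I0 I1)\<close>, which is the claim.

  For merely measurable \<open>F0\<close> and \<open>F1\<close> such curves need not be differentiable. So \<open>u\<close> and \<open>v\<close> are
  built from positive continuous densities close to \<open>F0\<close> and \<open>F1\<close> in mean, for which they are
  continuously differentiable, and the argument loses only a factor that tends to \<open>1\<close>
  (\<open>product_bound_by_approximate_transport\<close>). A truncation then removes the boundedness assumptions
  (\<open>four_functions_real_line\<close>). In higher dimensions, Fubini's theorem reduces the claim to the line:
  integrating out all coordinates but one leaves four marginals that again satisfy
  the hypothesis, by the claim in lower dimension (\<open>four_functions_PiM\<close>).\<close>

section \<open>A Cauchy-Schwarz inequality\<close>

text \<open>The square root needed to reduce this to the usual Cauchy-Schwarz inequality is extended by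
  the value \<open>\<infinity>\<close> at \<open>\<infinity>\<close>. Allowing infinite values matters below: the marginals of \<open>G0\<close> and \<open>G1\<close>
  that arise in the induction on the dimension can be infinite, and one of them can be infinite
  where the other one is zero.\<close>

lemma square_le_mult_imp_nn_integral_square_le:
  fixes a b p :: "'a \<Rightarrow> ennreal"
  assumes [measurable]: "a \<in> borel_measurable M" "b \<in> borel_measurable M"
    and le: "\<And>x. (p x)\<^sup>2 \<le> a x * b x"
  shows "(\<integral>\<^sup>+x. p x \<partial>M)\<^sup>2 \<le> (\<integral>\<^sup>+x. a x \<partial>M) * (\<integral>\<^sup>+x. b x \<partial>M)"
proof -
  define esqrt where "esqrt c = (if c = \<infinity> then \<infinity> else ennreal (sqrt (enn2real c)))" for c :: ennreal
  have esqrt_sq: "(esqrt c)\<^sup>2 = c" for c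
    by (cases c) (auto simp: esqrt_def ennreal_power)
  have [measurable]: "esqrt \<in> borel_measurable borel"
    unfolding esqrt_def by measurable
  have p_le: "p x \<le> esqrt (a x) * esqrt (b x)" for x
  proof (rule ccontr)
    assume "\<not> p x \<le> esqrt (a x) * esqrt (b x)"
    hence lt: "esqrt (a x) * esqrt (b x) < p x" by simp
    hence "(esqrt (a x) * esqrt (b x))\<^sup>2 < (p x)\<^sup>2"
      by (cases "esqrt (a x) * esqrt (b x)"; cases "p x")
        (auto simp: ennreal_power power2_eq_square ennreal_mult_less_top ennreal_less_iff
          intro!: mult_strict_mono simp flip: ennreal_mult)
    with le[of x] show False
      by (simp add: power_mult_distrib esqrt_sq)
  qed
  have "(\<integral>\<^sup>+x. p x \<partial>M)\<^sup>2 \<le> (\<integral>\<^sup>+x. esqrt (a x) * esqrt (b x) \<partial>M)\<^sup>2"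
    by (intro power_mono nn_integral_mono p_le) auto
  also have "\<dots> \<le> (\<integral>\<^sup>+x. (esqrt (a x))\<^sup>2 \<partial>M) * (\<integral>\<^sup>+x. (esqrt (b x))\<^sup>2 \<partial>M)"
    by (rule Cauchy_Schwarz_nn_integral) measurable
  finally show ?thesis by (simp add: esqrt_sq)
qed

section \<open>Parametrizing an interval by a positive density\<close>

text \<open>The function \<open>u\<close> is the quantile function of the probability density \<open>h / J\<close> on the interval: it
  carries Lebesgue measure on the unit interval to \<open>h dx / J\<close>. Two densities parametrized in
  this way over the same unit interval are transported onto each other monotonically, without any
  need to mention the transport map.\<close>

lemma uniform_parametrization_of_density:
  fixes h :: "real \<Rightarrow> real"
  assumes ab: "a < b" and h: "continuous_on UNIV h" "\<And>x. 0 < h x"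
  obtains J u where "0 < J" "(\<integral>\<^sup>+x. ennreal (h x) * indicator {a..b} x \<partial>lborel) = ennreal J"
    "u 0 = a" "u 1 = b" "\<And>t. t \<in> {0..1} \<Longrightarrow> u t \<in> {a..b}"
    "\<And>t. t \<in> {0..1} \<Longrightarrow> (u has_real_derivative J / h (u t)) (at t)"
proof -
  define H where "H x = integral {a - 1..x} h" for x
  have dH: "(H has_real_derivative h x) (at x)" if "a - 1 < x" "x < b + 1" for x
  proof -
    have "(H has_real_derivative h x) (at x within {a - 1..b + 1})"
      unfolding H_def using that
      by (intro integral_has_real_derivative continuous_on_subset[OF h(1)]) auto
    moreover have "at x within {a - 1..b + 1} = at x"
      by (rule at_within_interior) (use that in auto)
    ultimately show ?thesis by simp
  qed
  define J where "J = H b - H a"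
  have H_less: "H x < H y" if "a - 1 < x" "x < y" "y < b + 1" for x y
  proof (rule DERIV_pos_imp_increasing[OF that(2)])
    fix z assume "x \<le> z" "z \<le> y"
    thus "\<exists>d. (H has_real_derivative d) (at z) \<and> 0 < d"
      using dH[of z] h(2)[of z] that by (intro exI[of _ "h z"]) auto
  qed
  have J: "0 < J" unfolding J_def using H_less[of a b] ab by simp
  \<comment> \<open>The interval is enlarged so that its end points become interior points, where the inverse
    function theorem gives two-sided derivatives.\<close>
  define A B where "A = a - 1/2" and "B = b + 1/2"
  define \<Phi> where "\<Phi> x = (H x - H a) / J" for x
  have \<Phi>_less: "\<Phi> x < \<Phi> y" if "A \<le> x" "x < y" "y \<le> B" for x y
    unfolding \<Phi>_def using H_less[of x y] that J by (simp add: A_def B_def divide_strict_right_mono)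
  have inj: "inj_on \<Phi> {A..B}"
    by (rule linorder_inj_onI) (use \<Phi>_less in fastforce)+
  have d\<Phi>: "(\<Phi> has_real_derivative h x / J) (at x)" if "x \<in> {A..B}" for x
    unfolding \<Phi>_def using that J
    by (auto intro!: derivative_eq_intros dH simp: A_def B_def)
  have cont\<Phi>: "isCont \<Phi> x" if "x \<in> {A..B}" for x
    using d\<Phi>[OF that] by (rule DERIV_isCont)
  have \<Phi>_ab: "\<Phi> a = 0" "\<Phi> b = 1" using J by (auto simp: \<Phi>_def J_def)
  define u where "u = the_inv_into {A..B} \<Phi>"
  have u_\<Phi>: "u (\<Phi> x) = x" if "x \<in> {A..B}" for x
    unfolding u_def using inj that by (rule the_inv_into_f_f)
  have ABab: "A < a" "b < B" "a < b" using ab by (auto simp: A_def B_def)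
  have surj: "\<exists>x\<in>{p..q}. \<Phi> x = t" if "A \<le> p" "p \<le> q" "q \<le> B" "\<Phi> p \<le> t" "t \<le> \<Phi> q" for p q t
    using IVT[of \<Phi> p t q] that cont\<Phi> by auto
  have du: "u t \<in> {a..b} \<and> (u has_real_derivative J / h (u t)) (at t)" if t: "t \<in> {0..1}" for t
  proof -
    obtain x where x: "x \<in> {a..b}" "\<Phi> x = t"
      using surj[of a b t] ABab t \<Phi>_ab by auto
    have xu: "u t = x" using u_\<Phi>[of x] x ABab by auto
    have "isCont u (\<Phi> x)"
      by (rule isCont_inverse_function2[of A x B u \<Phi>]) (use x ABab u_\<Phi> cont\<Phi> in auto)
    moreover have "\<Phi> (u s) = s" if "\<Phi> A < s" "s < \<Phi> B" for s
      using surj[of A B s] that ABab u_\<Phi> by force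
    moreover have "\<Phi> A < t" "t < \<Phi> B"
      using \<Phi>_less[of A a] \<Phi>_less[of b B] \<Phi>_ab t ABab by auto
    ultimately have "(u has_real_derivative inverse (h x / J)) (at t)"
      using d\<Phi>[of x] x ABab J h(2)[of x]
      by (intro DERIV_inverse_function[where f = \<Phi> and a = "\<Phi> A" and b = "\<Phi> B"]) (auto simp: xu)
    thus ?thesis using x xu by (simp add: field_simps)
  qed
  have [measurable]: "h \<in> borel_measurable borel" 
    using h(1) by (rule borel_measurable_continuous_onI)
  have "(\<integral>\<^sup>+x. ennreal (h x) * indicator {a..b} x \<partial>lborel) = ennreal J"
    unfolding J_def
    by (rule nn_integral_FTC_Icc) (use ab dH h(2) less_imp_le in auto)
  moreover have "u 0 = a" "u 1 = b"
    using u_\<Phi>[of a] u_\<Phi>[of b] \<Phi>_ab ABab by auto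
  ultimately show thesis using that[of J u] J du by blast
qed

text \<open>A measurable function is the pointwise limit almost everywhere of continuous ones. Cutting these
  off at \<open>0\<close> and \<open>M\<close> makes dominated convergence applicable, and adding \<open>1 / (n + 1)\<close> makes them
  positive, as the parametrization requires.\<close>

lemma continuous_approximation_in_mean:
  fixes F :: "real \<Rightarrow> real"
  assumes F[measurable]: "F \<in> borel_measurable borel" and bd: "\<And>x. 0 \<le> F x" "\<And>x. F x \<le> M"
  obtains h :: "nat \<Rightarrow> real \<Rightarrow> real" where "\<And>n. continuous_on UNIV (h n)" "\<And>n x. 0 < h n x"
    "(\<lambda>n. \<integral>\<^sup>+x. ennreal (h n x) * indicator {a..b} x \<partial>lborel)
       \<longlonglongrightarrow> (\<integral>\<^sup>+x. ennreal (F x) * indicator {a..b} x \<partial>lborel)"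
    "(\<lambda>n. \<integral>\<^sup>+x. ennreal \<bar>F x - h n x\<bar> * indicator {a..b} x \<partial>lborel) \<longlonglongrightarrow> 0"
proof -
  have M: "0 \<le> M" using bd[of 0] by linarith
  have "F measurable_on UNIV"
    by (intro lebesgue_measurable_imp_measurable_on measurable_completion) auto
  then obtain N g where N: "negligible N" and g: "\<And>n. continuous_on UNIV (g n)"
    and lim: "\<And>x. x \<notin> N \<Longrightarrow> (\<lambda>n. g n x) \<longlonglongrightarrow> F x"
    unfolding measurable_on_def by auto
  define h where "h n x = max 0 (min M (g n x)) + 1 / real (Suc n)" for n x
  have cont: "continuous_on UNIV (h n)" for n
    unfolding h_def by (intro continuous_intros g)
  have pos: "0 < h n x" for n x
    unfolding h_def by (simp add: add_nonneg_pos)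
  have le: "h n x \<le> M + 1" for n x
    unfolding h_def using M by (intro add_mono) auto
  have [measurable]: "h n \<in> borel_measurable borel" for n
    using cont by (rule borel_measurable_continuous_onI)
  have "AE x in lebesgue. x \<notin> N"
    using N by (simp add: negligible_iff_null_sets AE_not_in)
  moreover have conv: "(\<lambda>n. h n x) \<longlonglongrightarrow> F x" if "x \<notin> N" for x
  proof -
    have "(\<lambda>n. max 0 (min M (g n x)) + 1 / real (Suc n)) \<longlonglongrightarrow> max 0 (min M (F x)) + 0"
      by (intro tendsto_intros lim that LIMSEQ_inverse_real_of_nat[unfolded inverse_eq_divide])
    thus ?thesis using bd[of x] by (simp add: h_def)
  qed
  ultimately have AE: "AE x in lborel. (\<lambda>n. h n x) \<longlonglongrightarrow> F x"
    by (subst AE_completion_iff[symmetric]) (auto elim: eventually_mono)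
  let ?w = "\<lambda>x. (M + 1) * indicator {a..b} x :: real"
  have w: "(\<integral>\<^sup>+x. ennreal (?w x) \<partial>lborel) < \<infinity>"
    using M by (simp add: ennreal_mult' ennreal_indicator nn_integral_cmult ennreal_mult_less_top
        emeasure_lborel_Icc_eq)
  have 1: "(\<lambda>n. \<integral>\<^sup>+x. ennreal (norm (F x * indicator {a..b} x - h n x * indicator {a..b} x)) \<partial>lborel) \<longlonglongrightarrow> 0"
  proof (rule nn_integral_dominated_convergence_norm[OF _ _ _ _ w])
    show "AE x in lborel. norm (h j x * indicator {a..b} x) \<le> ?w x" for j
      using pos[of j] le[of j] by (auto simp: indicator_def less_imp_le abs_of_pos)
    show "AE x in lborel. (\<lambda>n. h n x * indicator {a..b} x) \<longlonglongrightarrow> F x * indicator {a..b} x"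
      using AE by eventually_elim (intro tendsto_intros)
  qed measurable
  have 2: "(\<lambda>n. \<integral>\<^sup>+x. ennreal (h n x) * indicator {a..b} x \<partial>lborel)
       \<longlonglongrightarrow> (\<integral>\<^sup>+x. ennreal (F x) * indicator {a..b} x \<partial>lborel)"
  proof (rule nn_integral_dominated_convergence[OF _ _ _ _ w])
    show "AE x in lborel. ennreal (h j x) * indicator {a..b} x \<le> ennreal (?w x)" for j
      using le[of j] by (auto simp: indicator_def intro!: ennreal_leI)
    show "AE x in lborel. (\<lambda>n. ennreal (h n x) * indicator {a..b} x) \<longlonglongrightarrow> ennreal (F x) * indicator {a..b} x"
      using AE
    proof eventually_elim
      case (elim x)
      thus ?case by (cases "x \<in> {a..b}") auto
    qed
  qed measurable
  have "ennreal (norm (F x * indicator {a..b} x - h n x * indicator {a..b} x))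
      = ennreal \<bar>F x - h n x\<bar> * indicator {a..b} x" for n x
    by (simp add: indicator_def)
  with 1 2 cont pos show thesis by (intro that[of h]) simp_all
qed

section \<open>Approximate transport on the line\<close>

text \<open>This is what the exchange of the two weights between the factors is for. If both factors had the
  same weights, the inequality would fail for suitable positive \<open>a\<close> and \<open>b\<close> unless \<open>l = 1/2\<close>.\<close>

lemma mult_le_convex_combinations_mult:
  fixes a b l :: real
  assumes "0 \<le> l" "l \<le> 1"
  shows "a * b \<le> ((1 - l) * a + l * b) * (l * a + (1 - l) * b)"
proof -
  have "((1 - l) * a + l * b) * (l * a + (1 - l) * b) = a * b + l * (1 - l) * (a - b)\<^sup>2"
    by (simp add: power2_eq_square algebra_simps)
  moreover have "0 \<le> l * (1 - l) * (a - b)\<^sup>2" using assms by simp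
  ultimately show ?thesis by linarith
qed

text \<open>The measure \<open>h dx / J\<close> of the error relative to \<open>h\<close> is \<open>1 / J\<close> times the absolute error. So along
  the parametrization, \<open>F / h\<close> is close to \<open>1\<close> in mean as soon as \<open>F\<close> and \<open>h\<close> are close in mean.\<close>

lemma relative_error_along_parametrization:
  fixes F h u :: "real \<Rightarrow> real"
  assumes [measurable]: "F \<in> borel_measurable borel"
    and h: "continuous_on UNIV h" "\<And>x. 0 < h x" and J: "0 < J"
    and u: "u 0 = a" "u 1 = b" "\<And>t. t \<in> {0..1} \<Longrightarrow> (u has_real_derivative J / h (u t)) (at t)"
    and e: "(\<integral>\<^sup>+x. ennreal \<bar>F x - h x\<bar> * indicator {a..b} x \<partial>lborel) = ennreal e" "0 \<le> e"
  shows "(\<integral>\<^sup>+t. ennreal \<bar>F (u t) / h (u t) - 1\<bar> * indicator {0..1} t \<partial>lborel) = ennreal (e / J)"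
proof -
  have [measurable]: "h \<in> borel_measurable borel" 
    using h(1) by (rule borel_measurable_continuous_onI)
  have cu: "continuous_on {0..1} u"
    using u(3) by (rule has_real_derivative_imp_continuous_on)
  have hu: "continuous_on {0..1} (\<lambda>t. J / h (u t))"
    using h(2) by (intro continuous_intros continuous_on_compose2[OF h(1) cu]) (auto simp: less_le)
  have "ennreal (e / J) = ennreal (1 / J) * ennreal e"
    using J by (simp flip: ennreal_mult')
  also have "\<dots> = (\<integral>\<^sup>+x. ennreal (\<bar>F x - h x\<bar> / J) * indicator {u 0..u 1} x \<partial>lborel)"
    unfolding e(1)[symmetric] u(1,2) using J
    by (subst nn_integral_cmult[symmetric]) (auto simp: mult.assoc[symmetric] simp flip: ennreal_mult')
  also have "\<dots> = (\<integral>\<^sup>+t. ennreal (\<bar>F (u t) - h (u t)\<bar> / J) * ennreal (J / h (u t)) * indicator {0..1} t \<partial>lborel)"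
    by (rule nn_integral_substitution_aux) (use u(3) hu J h(2) in \<open>auto simp: less_imp_le\<close>)
  also have "\<dots> = (\<integral>\<^sup>+t. ennreal \<bar>F (u t) / h (u t) - 1\<bar> * indicator {0..1} t \<partial>lborel)"
  proof (rule nn_integral_cong)
    fix t
    have "\<bar>F (u t) - h (u t)\<bar> / J * (J / h (u t)) = \<bar>F (u t) / h (u t) - 1\<bar>"
      using h(2)[of "u t"] J by (simp add: abs_if field_simps)
    thus "ennreal (\<bar>F (u t) - h (u t)\<bar> / J) * ennreal (J / h (u t)) * indicator {0..1} t
        = ennreal \<bar>F (u t) / h (u t) - 1\<bar> * indicator {0..1} t"
      using J h(2)[of "u t"] by (simp flip: ennreal_mult')
  qed
  finally show ?thesis by simp
qed

lemma nn_integral_curve_le: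
  fixes G :: "real \<Rightarrow> ennreal"
  assumes [measurable]: "G \<in> borel_measurable borel"
    and w: "\<And>t. t \<in> {0..1} \<Longrightarrow> (w has_real_derivative w' t) (at t)"
    "continuous_on {0..1} w'" "\<And>t. t \<in> {0..1} \<Longrightarrow> 0 \<le> w' t"
  shows "(\<integral>\<^sup>+t. G (w t) * ennreal (w' t) * indicator {0..1} t \<partial>lborel) \<le> (\<integral>\<^sup>+x. G x \<partial>lborel)"
proof -
  have "(\<integral>\<^sup>+t. G (w t) * ennreal (w' t) * indicator {0..1} t \<partial>lborel)
      = (\<integral>\<^sup>+x. G x * indicator {w 0..w 1} x \<partial>lborel)"
    by (rule nn_integral_substitution_aux[symmetric]) (use w in auto)
  also have "\<dots> \<le> (\<integral>\<^sup>+x. G x \<partial>lborel)"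
    by (intro nn_integral_mono) (auto simp: indicator_def)
  finally show ?thesis .
qed

text \<open>Outside the unit interval the curve may be non-measurable; the indicator hides this.\<close>

lemma measurable_on_unit_interval:
  fixes G :: "real \<Rightarrow> ennreal"
  assumes [measurable]: "G \<in> borel_measurable borel"
    and w: "continuous_on {0..1} w" "continuous_on {0..1} w'"
  shows "(\<lambda>t. G (w t) * ennreal (w' t) * indicator {0..1::real} t) \<in> borel_measurable borel"
proof -
  have [measurable]: "(\<lambda>t. if t \<in> {0..1} then w t else 0) \<in> borel_measurable borel"
    "(\<lambda>t. if t \<in> {0..1} then w' t else 0) \<in> borel_measurable borel"
    by (rule borel_measurable_continuous_on_if[OF _ w(1)] borel_measurable_continuous_on_if[OF _ w(2)]; simp)+
  have "(\<lambda>t. G (if t \<in> {0..1} then w t else 0) * ennreal (if t \<in> {0..1} then w' t else 0)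
      * indicator {0..1::real} t) \<in> borel_measurable borel"
    by measurable
  also have "(\<lambda>t. G (if t \<in> {0..1} then w t else 0) * ennreal (if t \<in> {0..1} then w' t else 0)
      * indicator {0..1::real} t) = (\<lambda>t. G (w t) * ennreal (w' t) * indicator {0..1::real} t)"
    by (auto simp: indicator_def)
  finally show ?thesis .
qed

text \<open>Let \<open>u\<close> and \<open>v\<close> parametrize \<open>h0\<close> and \<open>h1\<close>, and let \<open>w0 = (1 - l) u + l v\<close> and
  \<open>w1 = l u + (1 - l) v\<close>. Integrating \<open>G0\<close> along \<open>w0\<close> and \<open>G1\<close> along \<open>w1\<close> and applying Cauchy-Schwarz
  bounds the product of the integrals from below by the square of the integral of a geometric mean.
  The hypothesis and \<open>w0' w1' \<ge> u' v'\<close> bound the square of that geometric mean from below by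
  \<open>F0(u) F1(v) u' v' = J0 J1 r q\<close>, where \<open>r = F0(u) / h0(u)\<close> and \<open>q = F1(v) / h1(v)\<close> are close to \<open>1\<close>
  in mean. Replacing \<open>r q\<close> by \<open>(min r q)\<^sup>2\<close> turns the closeness into an estimate that is linear in
  the two errors.

  The densities \<open>h0\<close> and \<open>h1\<close> only serve to define the curves, and the inequality on the four
  functions is never perturbed. This is why the approximation is harmless although nothing
  relates \<open>G0\<close> and \<open>G1\<close> to \<open>h0\<close> and \<open>h1\<close>.\<close>

lemma product_bound_by_approximate_transport:
  fixes F0 F1 h0 h1 :: "real \<Rightarrow> real" and G0 G1 :: "real \<Rightarrow> ennreal"
  assumes ab: "a < b" and l: "0 \<le> l" "l \<le> 1"
    and F0[measurable]: "F0 \<in> borel_measurable borel" and F1[measurable]: "F1 \<in> borel_measurable borel" 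
    and [measurable]: "G0 \<in> borel_measurable borel" "G1 \<in> borel_measurable borel"
    and F: "\<And>x. 0 \<le> F0 x" "\<And>x. 0 \<le> F1 x"
    and le: "\<And>x y. ennreal (F0 x * F1 y) \<le> G0 ((1 - l) * x + l * y) * G1 (l * x + (1 - l) * y)"
    and h0: "continuous_on UNIV h0" "\<And>x. 0 < h0 x" and h1: "continuous_on UNIV h1" "\<And>x. 0 < h1 x"
    and J0: "(\<integral>\<^sup>+x. ennreal (h0 x) * indicator {a..b} x \<partial>lborel) = ennreal J0" "0 \<le> J0"
    and J1: "(\<integral>\<^sup>+x. ennreal (h1 x) * indicator {a..b} x \<partial>lborel) = ennreal J1" "0 \<le> J1"
    and e0: "(\<integral>\<^sup>+x. ennreal \<bar>F0 x - h0 x\<bar> * indicator {a..b} x \<partial>lborel) = ennreal e0" "0 \<le> e0"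
    and e1: "(\<integral>\<^sup>+x. ennreal \<bar>F1 x - h1 x\<bar> * indicator {a..b} x \<partial>lborel) = ennreal e1" "0 \<le> e1"
  shows "ennreal (J0 * J1 * (max 0 (1 - e0 / J0 - e1 / J1))\<^sup>2)
    \<le> (\<integral>\<^sup>+x. G0 x \<partial>lborel) * (\<integral>\<^sup>+x. G1 x \<partial>lborel)"
proof -
  obtain J0' u where J0': "0 < J0'" "(\<integral>\<^sup>+x. ennreal (h0 x) * indicator {a..b} x \<partial>lborel) = ennreal J0'"
    and u: "u 0 = a" "u 1 = b" "\<And>t. t \<in> {0..1} \<Longrightarrow> u t \<in> {a..b}"
      "\<And>t. t \<in> {0..1} \<Longrightarrow> (u has_real_derivative J0' / h0 (u t)) (at t)"
    by (rule uniform_parametrization_of_density[OF ab h0]) (rule that)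
  obtain J1' v where J1': "0 < J1'" "(\<integral>\<^sup>+x. ennreal (h1 x) * indicator {a..b} x \<partial>lborel) = ennreal J1'"
    and v: "v 0 = a" "v 1 = b" "\<And>t. t \<in> {0..1} \<Longrightarrow> v t \<in> {a..b}"
      "\<And>t. t \<in> {0..1} \<Longrightarrow> (v has_real_derivative J1' / h1 (v t)) (at t)"
    by (rule uniform_parametrization_of_density[OF ab h1]) (rule that)
  have J: "J0' = J0" "J1' = J1" using J0 J0' J1 J1' by auto
  note u = u[unfolded J] and v = v[unfolded J]
  have pos: "0 < J0" "0 < J1" using J0' J1' J by auto
  define u' v' where "u' t = J0 / h0 (u t)" and "v' t = J1 / h1 (v t)" for t
  have pos': "0 < u' t" "0 < v' t" for t
    unfolding u'_def v'_def using pos h0(2) h1(2) by auto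
  have cu: "continuous_on {0..1} u" "continuous_on {0..1} v"
    by (rule has_real_derivative_imp_continuous_on[OF u(4)] has_real_derivative_imp_continuous_on[OF v(4)]; simp)+
  have cu': "continuous_on {0..1} u'" "continuous_on {0..1} v'"
    unfolding u'_def v'_def using h0(2) h1(2) 
    by (auto intro!: continuous_intros continuous_on_compose2[OF h0(1) cu(1)] 
        continuous_on_compose2[OF h1(1) cu(2)] simp: less_le)
  define w0 w0' where "w0 t = (1 - l) * u t + l * v t" and "w0' t = (1 - l) * u' t + l * v' t" for t
  define w1 w1' where "w1 t = l * u t + (1 - l) * v t" and "w1' t = l * u' t + (1 - l) * v' t" for t
  have w': "0 \<le> w0' t" "0 \<le> w1' t" for t
    unfolding w0'_def w1'_def using pos'[of t] l by simp_all
  have cw: "continuous_on {0..1} w0" "continuous_on {0..1} w1" 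
    "continuous_on {0..1} w0'" "continuous_on {0..1} w1'"
    unfolding w0_def w1_def w0'_def w1'_def by (intro continuous_intros cu cu')+
  have dw: "(w0 has_real_derivative w0' t) (at t)" "(w1 has_real_derivative w1' t) (at t)" 
    if "t \<in> {0..1}" for t
    unfolding w0_def w1_def w0'_def w1'_def u'_def v'_def
    by (auto intro!: derivative_eq_intros u(4) v(4) that simp: mult.commute)
  define r q where "r t = F0 (u t) / h0 (u t)" and "q t = F1 (v t) / h1 (v t)" for t
  have rq: "0 \<le> r t" "0 \<le> q t" for t
    unfolding r_def q_def using F h0(2) h1(2) by (auto intro!: divide_nonneg_pos)
  define m where "m t = min (r t) (q t)" for t
  define p where "p t = ennreal (m t) * indicator {0..1::real} t" for t
  define P where "P = (\<integral>\<^sup>+t. p t \<partial>lborel)"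
  define c where "c = sqrt (J0 * J1)"
  have c: "0 \<le> c" "c\<^sup>2 = J0 * J1" unfolding c_def using pos by auto
  let ?A = "\<lambda>t. G0 (w0 t) * ennreal (w0' t) * indicator {0..1::real} t"
  let ?B = "\<lambda>t. G1 (w1 t) * ennreal (w1' t) * indicator {0..1::real} t"
  have [measurable]: "?A \<in> borel_measurable borel" "?B \<in> borel_measurable borel"
    by (intro measurable_on_unit_interval cw; measurable)+
  have pointwise: "(ennreal c * p t)\<^sup>2 \<le> ?A t * ?B t" for t
  proof (cases "t \<in> {0..1}")
    case True
    have "(c * m t)\<^sup>2 \<le> (J0 * J1) * (r t * q t)"
      unfolding power_mult_distrib c(2) m_def power2_eq_square[of "min _ _"] using rq[of t] pos
      by (intro mult_left_mono mult_mono) auto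
    also have "\<dots> = F0 (u t) * F1 (v t) * (u' t * v' t)"
      by (simp add: r_def q_def u'_def v'_def)
    also have "\<dots> \<le> F0 (u t) * F1 (v t) * (w0' t * w1' t)"
      unfolding w0'_def w1'_def using F by (intro mult_left_mono mult_le_convex_combinations_mult l) auto
    finally have "ennreal ((c * m t)\<^sup>2) \<le> ennreal (F0 (u t) * F1 (v t) * (w0' t * w1' t))"
      by (rule ennreal_leI)
    also have "\<dots> = ennreal (F0 (u t) * F1 (v t)) * (ennreal (w0' t) * ennreal (w1' t))"
      using F w' by (simp flip: ennreal_mult')
    also have "\<dots> \<le> (G0 (w0 t) * G1 (w1 t)) * (ennreal (w0' t) * ennreal (w1' t))"
      using le[of "u t" "v t"] by (intro mult_right_mono) (auto simp: w0_def w1_def)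
    finally show ?thesis using True c rq[of t]
      by (simp add: p_def ac_simps ennreal_mult' ennreal_power[symmetric] m_def)
  qed (simp add: p_def)
  define R Q where "R t = ennreal (r t) * indicator {0..1::real} t" 
    and "Q t = ennreal (q t) * indicator {0..1::real} t" for t
  have "R = (\<lambda>t. ennreal (F0 (u t)) * ennreal (1 / h0 (u t)) * indicator {0..1} t)"
    unfolding R_def r_def using F(1) by (simp add: fun_eq_iff flip: ennreal_mult')
  moreover have "continuous_on {0..1} (\<lambda>t. 1 / h0 (u t))"
    using h0(2) by (intro continuous_intros continuous_on_compose2[OF h0(1) cu(1)]) (auto simp: less_le)
  ultimately have [measurable]: "R \<in> borel_measurable borel"
    using measurable_on_unit_interval[where G="\<lambda>x. ennreal (F0 x)", OF _ cu(1)] by simp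
  have "Q = (\<lambda>t. ennreal (F1 (v t)) * ennreal (1 / h1 (v t)) * indicator {0..1} t)"
    unfolding Q_def q_def using F(2) by (simp add: fun_eq_iff flip: ennreal_mult')
  moreover have "continuous_on {0..1} (\<lambda>t. 1 / h1 (v t))"
    using h1(2) by (intro continuous_intros continuous_on_compose2[OF h1(1) cu(2)]) (auto simp: less_le)
  ultimately have [measurable]: "Q \<in> borel_measurable borel"
    using measurable_on_unit_interval[where G="\<lambda>x. ennreal (F1 x)", OF _ cu(2)] by simp
  have p_eq: "p = (\<lambda>t. min (R t) (Q t))"
  proof
    have "ennreal (min x y) = min (ennreal x) (ennreal y)" for x y
      by (rule min_of_mono[symmetric]) (auto intro: monoI ennreal_leI)
    thus "p t = min (R t) (Q t)" for t
      by (simp add: p_def m_def R_def Q_def indicator_def)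
  qed
  have pm[measurable]: "p \<in> borel_measurable borel" 
    unfolding p_eq by measurable
  have G: "ennreal (J0 * J1) * P\<^sup>2 \<le> (\<integral>\<^sup>+x. G0 x \<partial>lborel) * (\<integral>\<^sup>+x. G1 x \<partial>lborel)"
  proof -
    have "ennreal (J0 * J1) * P\<^sup>2 = (\<integral>\<^sup>+t. ennreal c * p t \<partial>lborel)\<^sup>2"
      unfolding P_def using c by (simp add: nn_integral_cmult power_mult_distrib ennreal_power)
    also have "\<dots> \<le> (\<integral>\<^sup>+t. ?A t \<partial>lborel) * (\<integral>\<^sup>+t. ?B t \<partial>lborel)"
      by (rule square_le_mult_imp_nn_integral_square_le) (use pointwise in auto)
    also have "\<dots> \<le> (\<integral>\<^sup>+x. G0 x \<partial>lborel) * (\<integral>\<^sup>+x. G1 x \<partial>lborel)"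
      using dw cw w' by (intro mult_mono nn_integral_curve_le) auto
    finally show ?thesis .
  qed
  let ?E0 = "\<lambda>t. ennreal \<bar>r t - 1\<bar> * indicator {0..1} t"
  let ?E1 = "\<lambda>t. ennreal \<bar>q t - 1\<bar> * indicator {0..1} t"
  have E: "(\<integral>\<^sup>+t. ?E0 t \<partial>lborel) = ennreal (e0 / J0)" "(\<integral>\<^sup>+t. ?E1 t \<partial>lborel) = ennreal (e1 / J1)"
    unfolding r_def q_def
    using relative_error_along_parametrization[OF F0 h0 pos(1) u(1,2,4) e0]
      relative_error_along_parametrization[OF F1 h1 pos(2) v(1,2,4) e1] by auto
  have "?E0 = (\<lambda>t. ennreal \<bar>enn2real (R t) - 1\<bar> * indicator {0..1} t)"
    "?E1 = (\<lambda>t. ennreal \<bar>enn2real (Q t) - 1\<bar> * indicator {0..1} t)"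
    using rq by (auto simp: fun_eq_iff R_def Q_def indicator_def)
  hence Em: "?E0 \<in> borel_measurable borel" "?E1 \<in> borel_measurable borel"
    by simp_all
  have "1 = (\<integral>\<^sup>+t. indicator {0..1::real} t \<partial>lborel)" by simp
  also have "\<dots> \<le> (\<integral>\<^sup>+t. p t + (?E0 t + ?E1 t) \<partial>lborel)"
  proof (rule nn_integral_mono)
    fix t :: real
    have "1 \<le> m t + (\<bar>r t - 1\<bar> + \<bar>q t - 1\<bar>)" unfolding m_def by linarith
    hence "ennreal 1 \<le> ennreal (m t + (\<bar>r t - 1\<bar> + \<bar>q t - 1\<bar>))" by (rule ennreal_leI)
    thus "indicator {0..1} t \<le> p t + (?E0 t + ?E1 t)"
      using rq[of t] by (simp add: indicator_def p_def m_def)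
  qed
  also have "\<dots> = P + (ennreal (e0 / J0) + ennreal (e1 / J1))"
    unfolding P_def E[symmetric]
    using Em by (simp add: nn_integral_add)
  finally have P: "1 \<le> P + (ennreal (e0 / J0) + ennreal (e1 / J1))" .
  have "ennreal (max 0 (1 - e0 / J0 - e1 / J1)) \<le> P"
  proof (cases P)
    case (real x)
    from P have "ennreal 1 \<le> ennreal (x + (e0 / J0 + e1 / J1))"
      using e0(2) e1(2) pos real by simp
    hence "1 \<le> x + (e0 / J0 + e1 / J1)"
      using e0(2) e1(2) pos real by (subst (asm) ennreal_le_iff) auto
    thus ?thesis using real by (auto intro!: ennreal_leI)
  qed simp
  hence "ennreal (J0 * J1) * (ennreal (max 0 (1 - e0 / J0 - e1 / J1)))\<^sup>2 \<le> ennreal (J0 * J1) * P\<^sup>2"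
    by (intro mult_left_mono power_mono) auto
  with G have "ennreal (J0 * J1) * (ennreal (max 0 (1 - e0 / J0 - e1 / J1)))\<^sup>2 
      \<le> (\<integral>\<^sup>+x. G0 x \<partial>lborel) * (\<integral>\<^sup>+x. G1 x \<partial>lborel)"
    by (rule order_trans[rotated])
  thus ?thesis using pos by (simp add: ennreal_mult' ennreal_power)
qed

section \<open>The inequality on the real line\<close>

text \<open>The bound by approximate transport is applied to positive continuous \<open>h0\<close>, \<open>h1\<close> that converge to
  \<open>F0\<close>, \<open>F1\<close> in mean. If both limits have positive integral, the relative errors tend to \<open>0\<close> and the
  masses of \<open>h0\<close>, \<open>h1\<close> to those of \<open>F0\<close>, \<open>F1\<close>.\<close>

lemma bounded_functions_on_interval:
  fixes F0 F1 :: "real \<Rightarrow> real" and G0 G1 :: "real \<Rightarrow> ennreal"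
  assumes ab: "a < b" and l: "0 \<le> l" "l \<le> 1"
    and F0m[measurable]: "F0 \<in> borel_measurable borel" and F1m[measurable]: "F1 \<in> borel_measurable borel" 
    and Gm: "G0 \<in> borel_measurable borel" "G1 \<in> borel_measurable borel"
    and F0: "\<And>x. 0 \<le> F0 x" "\<And>x. F0 x \<le> M" and F1: "\<And>x. 0 \<le> F1 x" "\<And>x. F1 x \<le> M"
    and le: "\<And>x y. ennreal (F0 x * F1 y) \<le> G0 ((1 - l) * x + l * y) * G1 (l * x + (1 - l) * y)"
  shows "(\<integral>\<^sup>+x. ennreal (F0 x) * indicator {a..b} x \<partial>lborel)
      * (\<integral>\<^sup>+x. ennreal (F1 x) * indicator {a..b} x \<partial>lborel)
    \<le> (\<integral>\<^sup>+x. G0 x \<partial>lborel) * (\<integral>\<^sup>+x. G1 x \<partial>lborel)" (is "?I0 * ?I1 \<le> ?R")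
proof (cases "?I0 = 0 \<or> ?I1 = 0")
  case False
  have fin: "(\<integral>\<^sup>+x. ennreal (F x) * indicator {a..b} x \<partial>lborel) < \<infinity>" if "\<And>x. F x \<le> M" for F :: "real \<Rightarrow> real"
  proof -
    have "(\<integral>\<^sup>+x. ennreal (F x) * indicator {a..b} x \<partial>lborel) \<le> (\<integral>\<^sup>+x. ennreal M * indicator {a..b} x \<partial>lborel)"
      by (intro nn_integral_mono mult_right_mono ennreal_leI that) auto
    also have "\<dots> < \<infinity>" 
      using ab by (simp add: nn_integral_cmult ennreal_mult_less_top)
    finally show ?thesis .
  qed
  obtain i0 where i0: "?I0 = ennreal i0" "0 \<le> i0" using fin[of F0, OF F0(2)] by (cases ?I0) auto
  obtain i1 where i1: "?I1 = ennreal i1" "0 \<le> i1" using fin[of F1, OF F1(2)] by (cases ?I1) auto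
  have ipos: "0 < i0" "0 < i1" using False i0 i1 by (auto simp: less_le)
  obtain h0 where h0: "\<And>n. continuous_on UNIV (h0 n)" "\<And>n x. 0 < h0 n x"
    and J0: "(\<lambda>n. \<integral>\<^sup>+x. ennreal (h0 n x) * indicator {a..b} x \<partial>lborel) \<longlonglongrightarrow> ?I0"
    and e0: "(\<lambda>n. \<integral>\<^sup>+x. ennreal \<bar>F0 x - h0 n x\<bar> * indicator {a..b} x \<partial>lborel) \<longlonglongrightarrow> 0"
    by (rule continuous_approximation_in_mean[OF F0m F0]) (rule that)
  obtain h1 where h1: "\<And>n. continuous_on UNIV (h1 n)" "\<And>n x. 0 < h1 n x"
    and J1: "(\<lambda>n. \<integral>\<^sup>+x. ennreal (h1 n x) * indicator {a..b} x \<partial>lborel) \<longlonglongrightarrow> ?I1"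
    and e1: "(\<lambda>n. \<integral>\<^sup>+x. ennreal \<bar>F1 x - h1 n x\<bar> * indicator {a..b} x \<partial>lborel) \<longlonglongrightarrow> 0"
    by (rule continuous_approximation_in_mean[OF F1m F1]) (rule that)
  have real: "(\<lambda>n. enn2real (X n)) \<longlonglongrightarrow> x" "eventually (\<lambda>n. X n = ennreal (enn2real (X n))) sequentially"
    if "X \<longlonglongrightarrow> ennreal x" "0 \<le> x" for X :: "nat \<Rightarrow> ennreal" and x
  proof -
    show "(\<lambda>n. enn2real (X n)) \<longlonglongrightarrow> x"
      using that by (rule tendsto_enn2real)
    have "eventually (\<lambda>n. X n < top) sequentially"
      using that by (intro order_tendstoD) auto
    thus "eventually (\<lambda>n. X n = ennreal (enn2real (X n))) sequentially"
      by eventually_elim simp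
  qed
  note rJ0 = real[OF J0[unfolded i0(1)] i0(2)] and rJ1 = real[OF J1[unfolded i1(1)] i1(2)]
    and re0 = real[OF e0[folded ennreal_0] order_refl] and re1 = real[OF e1[folded ennreal_0] order_refl]
  let ?j0 = "\<lambda>n. enn2real (\<integral>\<^sup>+x. ennreal (h0 n x) * indicator {a..b} x \<partial>lborel)"
  let ?j1 = "\<lambda>n. enn2real (\<integral>\<^sup>+x. ennreal (h1 n x) * indicator {a..b} x \<partial>lborel)"
  let ?d0 = "\<lambda>n. enn2real (\<integral>\<^sup>+x. ennreal \<bar>F0 x - h0 n x\<bar> * indicator {a..b} x \<partial>lborel)"
  let ?d1 = "\<lambda>n. enn2real (\<integral>\<^sup>+x. ennreal \<bar>F1 x - h1 n x\<bar> * indicator {a..b} x \<partial>lborel)"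
  let ?L = "\<lambda>n. ?j0 n * ?j1 n * (max 0 (1 - ?d0 n / ?j0 n - ?d1 n / ?j1 n))\<^sup>2"
  have "eventually (\<lambda>n. ennreal (?L n) \<le> ?R) sequentially"
    using rJ0(2) rJ1(2) re0(2) re1(2)
    by eventually_elim
      (rule product_bound_by_approximate_transport[OF ab l F0m F1m Gm F0(1) F1(1) le h0 h1],
        auto)
  moreover have "(\<lambda>n. ennreal (?L n)) \<longlonglongrightarrow> ennreal (i0 * i1 * (max 0 (1 - 0 / i0 - 0 / i1))\<^sup>2)"
    using ipos by (intro tendsto_ennrealI tendsto_intros rJ0(1) rJ1(1) re0(1) re1(1)) auto
  ultimately have "ennreal (i0 * i1 * (max 0 (1 - 0 / i0 - 0 / i1))\<^sup>2) \<le> ?R"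
    by (intro tendsto_upperbound[where F = sequentially]) auto
  thus ?thesis using i0 i1 by (simp add: ennreal_mult)
qed auto

text \<open>The hypothesis survives when \<open>F0\<close> and \<open>F1\<close> are made smaller, so they may be cut off at height \<open>n\<close>
  and restricted to \<open>[-n, n]\<close> while \<open>G0\<close> and \<open>G1\<close> stay as they are; monotone convergence does
  the rest.\<close>

lemma four_functions_real_line:
  fixes F0 F1 G0 G1 :: "real \<Rightarrow> ennreal"
  assumes l: "0 \<le> l" "l \<le> 1"
    and [measurable]: "F0 \<in> borel_measurable borel" "F1 \<in> borel_measurable borel" 
    and Gm: "G0 \<in> borel_measurable borel" "G1 \<in> borel_measurable borel"
    and le: "\<And>x y. F0 x * F1 y \<le> G0 ((1 - l) * x + l * y) * G1 (l * x + (1 - l) * y)"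
  shows "(\<integral>\<^sup>+x. F0 x \<partial>lborel) * (\<integral>\<^sup>+x. F1 x \<partial>lborel) \<le> (\<integral>\<^sup>+x. G0 x \<partial>lborel) * (\<integral>\<^sup>+x. G1 x \<partial>lborel)"
    (is "_ \<le> ?R")
proof -
  define T where "T F n x = enn2real (min (F x) (of_nat n))" for F :: "real \<Rightarrow> ennreal" and n x
  have T: "ennreal (T F n x) = min (F x) (of_nat n)" for F n x
    unfolding T_def by (rule ennreal_enn2real) (simp add: min_less_iff_disj of_nat_less_top)
  have T_bd: "0 \<le> T F n x" "T F n x \<le> real n" for F n x
  proof -
    show "0 \<le> T F n x" by (simp add: T_def)
    have "ennreal (T F n x) \<le> ennreal (real n)" unfolding T by (simp add: ennreal_of_nat_eq_real_of_nat)
    thus "T F n x \<le> real n" by (subst (asm) ennreal_le_iff) auto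
  qed
  have Tm[measurable]: "T F n \<in> borel_measurable borel" if [measurable]: "F \<in> borel_measurable borel" for F n
    unfolding T_def by measurable
  define I where "I F n = (\<integral>\<^sup>+x. ennreal (T F n x) * indicator {- real n..real n} x \<partial>lborel)" for F n
  have mono: "incseq (\<lambda>n x. ennreal (T F n x) * indicator {- real n..real n} x)" for F
    by (auto simp: incseq_def le_fun_def T indicator_def min_le_iff_disj intro: order_trans)
  have I_mono: "I F n \<le> I F k" if "n \<le> k" for F n k
    unfolding I_def using mono[of F] that by (intro nn_integral_mono) (auto simp: incseq_def le_fun_def)
  have lim: "(SUP n. ennreal (T F n x) * indicator {- real n..real n} x) = F x" for F x
  proof (rule LIMSEQ_unique[OF LIMSEQ_SUP])
    show "incseq (\<lambda>n. ennreal (T F n x) * indicator {- real n..real n} x)"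
      using mono[of F] by (auto simp: incseq_def le_fun_def)
    obtain N where N: "\<bar>x\<bar> \<le> real N" using real_arch_simple by blast
    have "(\<lambda>n. min (F x) (of_nat n)) \<longlonglongrightarrow> min (F x) top"
      by (intro tendsto_min tendsto_const of_nat_tendsto_top_ennreal)
    moreover have "\<forall>\<^sub>F n in sequentially. min (F x) (of_nat n) = ennreal (T F n x) * indicator {- real n..real n} x"
      using N by (auto simp: T indicator_def intro!: eventually_sequentiallyI[of N])
    ultimately show "(\<lambda>n. ennreal (T F n x) * indicator {- real n..real n} x) \<longlonglongrightarrow> F x"
      by (simp add: tendsto_cong)
  qed
  have SUP: "(\<integral>\<^sup>+x. F x \<partial>lborel) = (SUP n. I F n)" if [measurable]: "F \<in> borel_measurable borel" for F
    unfolding I_def using mono[of F] 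
    by (subst nn_integral_monotone_convergence_SUP[symmetric]) (auto simp: lim)
  have diag: "I F0 n * I F1 n \<le> ?R" for n
  proof (cases "n = 0")
    case False
    have T_le: "ennreal (T F0 n x * T F1 n y) \<le> F0 x * F1 y" for x y
      using T_bd by (auto simp: ennreal_mult T intro!: mult_mono)
    thus ?thesis unfolding I_def using False
      by (intro bounded_functions_on_interval[where M = "real n" and l = l] l Gm T_bd
          order_trans[OF T_le le]) auto
  qed (simp add: I_def T)
  \<comment> \<open>The two truncation levels are decoupled, because suprema can be pulled out of a product in
    \<open>[0, \<infinity>]\<close> only one factor at a time.\<close>
  have "I F0 n * I F1 k \<le> ?R" for n k
    using mult_mono[OF I_mono[of n "max n k" F0] I_mono[of k "max n k" F1]] diag[of "max n k"]
    by (auto intro: order_trans)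
  hence "(SUP n. I F0 n) * (SUP n. I F1 n) \<le> ?R"
    by (auto simp: SUP_mult_left_ennreal SUP_mult_right_ennreal intro!: SUP_least)
  thus ?thesis by (simp add: SUP)
qed

section \<open>Higher dimensions\<close>

text \<open>The statement tensorizes. For fixed values \<open>s\<close> and \<open>t\<close> of the new coordinate, the sections of the
  four functions satisfy the hypothesis in the remaining coordinates; the conclusion obtained for
  them says that the four marginals satisfy the hypothesis on the line.\<close>

lemma four_functions_PiM:
  fixes F0 F1 G0 G1 :: "('i \<Rightarrow> real) \<Rightarrow> ennreal"
  assumes l: "0 \<le> l" "l \<le> 1" and "finite I"
    and "F0 \<in> borel_measurable (Pi\<^sub>M I (\<lambda>_. lborel))" "F1 \<in> borel_measurable (Pi\<^sub>M I (\<lambda>_. lborel))"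
    "G0 \<in> borel_measurable (Pi\<^sub>M I (\<lambda>_. lborel))" "G1 \<in> borel_measurable (Pi\<^sub>M I (\<lambda>_. lborel))"
    and "\<And>x y. x \<in> space (Pi\<^sub>M I (\<lambda>_. lborel)) \<Longrightarrow> y \<in> space (Pi\<^sub>M I (\<lambda>_. lborel)) \<Longrightarrow>
      F0 x * F1 y \<le> G0 (\<lambda>i\<in>I. (1 - l) * x i + l * y i) * G1 (\<lambda>i\<in>I. l * x i + (1 - l) * y i)"
  shows "(\<integral>\<^sup>+x. F0 x \<partial>Pi\<^sub>M I (\<lambda>_. lborel)) * (\<integral>\<^sup>+x. F1 x \<partial>Pi\<^sub>M I (\<lambda>_. lborel))
    \<le> (\<integral>\<^sup>+x. G0 x \<partial>Pi\<^sub>M I (\<lambda>_. lborel)) * (\<integral>\<^sup>+x. G1 x \<partial>Pi\<^sub>M I (\<lambda>_. lborel))"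
  using assms(3-)
proof (induction I arbitrary: F0 F1 G0 G1 rule: finite_induct)
  case empty
  interpret product_sigma_finite "\<lambda>_. lborel :: real measure"
    by standard
  from empty.prems(5)[of "\<lambda>_. undefined" "\<lambda>_. undefined"] show ?case
    by (simp add: nn_integral_empty space_PiM restrict_def)
next
  case (insert i I)
  interpret product_sigma_finite "\<lambda>_. lborel :: real measure"
    by standard
  note [measurable] = insert.prems(1-4)
  let ?M = "Pi\<^sub>M I (\<lambda>_. lborel :: real measure)"
  note split = product_nn_integral_insert_rev[OF insert.hyps(1,2)]
  interpret I: sigma_finite_measure ?M
    using insert.hyps(1) by (rule sigma_finite)
  have section_measurable: "(\<lambda>s. \<integral>\<^sup>+x. F (x(i := s)) \<partial>?M) \<in> borel_measurable borel"
    if [measurable]: "F \<in> borel_measurable (Pi\<^sub>M (insert i I) (\<lambda>_. lborel))" for F :: "('i \<Rightarrow> real) \<Rightarrow> ennreal"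
  proof -
    have "(\<lambda>s. \<integral>\<^sup>+x. F (x(i := s)) \<partial>?M) \<in> borel_measurable lborel"
      by measurable
    thus ?thesis by simp
  qed
  show ?case
    unfolding split[OF insert.prems(1)] split[OF insert.prems(2)] split[OF insert.prems(3)] split[OF insert.prems(4)]
  proof (rule four_functions_real_line[OF l])
    fix s t :: real
    show "(\<integral>\<^sup>+x. F0 (x(i := s)) \<partial>?M) * (\<integral>\<^sup>+x. F1 (x(i := t)) \<partial>?M)
      \<le> (\<integral>\<^sup>+x. G0 (x(i := (1 - l) * s + l * t)) \<partial>?M) * (\<integral>\<^sup>+x. G1 (x(i := l * s + (1 - l) * t)) \<partial>?M)"
    proof (rule insert.IH)
      fix x y assume x: "x \<in> space ?M" and y: "y \<in> space ?M"
      have eq: "(\<lambda>j\<in>insert i I. \<alpha> * (x(i := s)) j + \<beta> * (y(i := t)) j)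
          = (\<lambda>j\<in>I. \<alpha> * x j + \<beta> * y j)(i := \<alpha> * s + \<beta> * t)" for \<alpha> \<beta> :: real
        using insert.hyps by (auto simp: fun_eq_iff restrict_def)
      have "x(i := s) \<in> space (Pi\<^sub>M (insert i I) (\<lambda>_. lborel))" "y(i := t) \<in> space (Pi\<^sub>M (insert i I) (\<lambda>_. lborel))"
        using x y by (auto simp: space_PiM PiE_def extensional_def)
      from insert.prems(5)[OF this, unfolded eq]
      show "F0 (x(i := s)) * F1 (y(i := t))
        \<le> G0 ((\<lambda>j\<in>I. (1 - l) * x j + l * y j)(i := (1 - l) * s + l * t))
          * G1 ((\<lambda>j\<in>I. l * x j + (1 - l) * y j)(i := l * s + (1 - l) * t))" .
    qed measurable
  qed (intro section_measurable insert.prems)+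
qed

text \<open>Lebesgue measure is the image of the product measure under the linear map that assembles a vector
  from its coordinates, and linear maps respect the combinations in the hypothesis.\<close>

theorem four_functions_euclidean:
  fixes F0 F1 G0 G1 :: "'a::euclidean_space \<Rightarrow> ennreal"
  assumes l: "0 \<le> l" "l \<le> 1"
    and [measurable]: "F0 \<in> borel_measurable borel" "F1 \<in> borel_measurable borel" 
      "G0 \<in> borel_measurable borel" "G1 \<in> borel_measurable borel"
    and le: "\<And>x y. F0 x * F1 y \<le> G0 ((1 - l) *\<^sub>R x + l *\<^sub>R y) * G1 (l *\<^sub>R x + (1 - l) *\<^sub>R y)"
  shows "(\<integral>\<^sup>+x. F0 x \<partial>lborel) * (\<integral>\<^sup>+x. F1 x \<partial>lborel) \<le> (\<integral>\<^sup>+x. G0 x \<partial>lborel) * (\<integral>\<^sup>+x. G1 x \<partial>lborel)"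
proof -
  define \<phi> :: "('a \<Rightarrow> real) \<Rightarrow> 'a" where "\<phi> f = (\<Sum>b\<in>Basis. f b *\<^sub>R b)" for f
  have [measurable]: "\<phi> \<in> Pi\<^sub>M Basis (\<lambda>_. lborel) \<rightarrow>\<^sub>M borel"
    unfolding \<phi>_def by measurable
  have coord: "(\<integral>\<^sup>+x. F x \<partial>lborel) = (\<integral>\<^sup>+f. F (\<phi> f) \<partial>Pi\<^sub>M Basis (\<lambda>_. lborel))"
    if [measurable]: "F \<in> borel_measurable borel" for F :: "'a \<Rightarrow> ennreal"
    unfolding \<phi>_def by (subst lborel_eq) (simp add: nn_integral_distr)
  have lin: "\<phi> (\<lambda>b\<in>Basis. \<alpha> * x b + \<beta> * y b) = \<alpha> *\<^sub>R \<phi> x + \<beta> *\<^sub>R \<phi> y" for \<alpha> \<beta> x y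
    by (simp add: \<phi>_def scaleR_left_distrib sum.distrib scaleR_sum_right)
  show ?thesis unfolding coord[OF assms(3)] coord[OF assms(4)] coord[OF assms(5)] coord[OF assms(6)]
  proof (rule four_functions_PiM[OF l finite_Basis])
    show "F0 (\<phi> x) * F1 (\<phi> y)
      \<le> G0 (\<phi> (\<lambda>i\<in>Basis. (1 - l) * x i + l * y i)) * G1 (\<phi> (\<lambda>i\<in>Basis. l * x i + (1 - l) * y i))" for x y
      unfolding lin by (rule le)
  qed measurable
qed

section \<open>The inequality for exponentials\<close>

text \<open>The conventions on infinite values agree: the extended reals have \<open>\<infinity> + (- \<infinity>) = \<infinity>\<close>, and
  correspondingly \<open>0 * \<infinity> = 0\<close> on the multiplicative side.\<close>

lemma exp_ereal_uminus_add: "exp_ereal (- (a + b)) = exp_ereal (- a) * exp_ereal (- b)"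
  by (cases a; cases b) (simp_all add: ennreal_mult_top ennreal_top_mult mult_exp_exp flip: ennreal_mult')

lemma exp_ereal_mono: "s \<le> t \<Longrightarrow> exp_ereal s \<le> exp_ereal t"
  by (cases s; cases t) (auto intro!: ennreal_leI)

lemma borel_measurable_exp_ereal [measurable]: "exp_ereal \<in> borel_measurable borel"
proof -
  have "exp_ereal = (\<lambda>t. if t = \<infinity> then \<infinity> else if t = - \<infinity> then 0 else ennreal (exp (real_of_ereal t)))"
    by (rule ext) (auto simp: exp_ereal_def split: ereal.splits)
  thus ?thesis by (rule ssubst) measurable
qed

theorem proposition1p2:
  fixes f0 f1 g0 g1 :: "real ^ 'n \<Rightarrow> ereal"
  assumes "f0 \<in> borel_measurable borel" and "f1 \<in> borel_measurable borel"
    and "g0 \<in> borel_measurable borel" and "g1 \<in> borel_measurable borel"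
    and "\<And>x. f0 x \<noteq> - \<infinity>" and "\<And>x. f1 x \<noteq> - \<infinity>"
    and "\<And>x. g0 x \<noteq> - \<infinity>" and "\<And>x. g1 x \<noteq> - \<infinity>"
    and "\<And>x0 x1. g0 ((2/3) *\<^sub>R x0 + (1/3) *\<^sub>R x1) + g1 ((1/3) *\<^sub>R x0 + (2/3) *\<^sub>R x1)
           \<le> f0 x0 + f1 x1"
  shows "(\<integral>\<^sup>+ x. exp_ereal (- g0 x) \<partial>lborel) * (\<integral>\<^sup>+ x. exp_ereal (- g1 x) \<partial>lborel)
         \<ge> (\<integral>\<^sup>+ x. exp_ereal (- f0 x) \<partial>lborel) * (\<integral>\<^sup>+ x. exp_ereal (- f1 x) \<partial>lborel)"
proof -
  note [measurable] = assms(1-4)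
  show ?thesis
  proof (rule four_functions_euclidean[where l = "1/3"])
    fix x y :: "real ^ 'n"
    show "exp_ereal (- f0 x) * exp_ereal (- f1 y)
      \<le> exp_ereal (- g0 ((1 - 1/3) *\<^sub>R x + (1/3) *\<^sub>R y)) * exp_ereal (- g1 ((1/3) *\<^sub>R x + (1 - 1/3) *\<^sub>R y))"
      using assms(9)[of x y] by (subst (1 2) exp_ereal_uminus_add[symmetric]) (simp add: exp_ereal_mono)
  qed simp_all
qed

end
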